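(* Let $A=(a_{n,k}: n,k\in\omega)$ be an infinite real matrix with $A\in(\ell_\infty,\ell_\infty)$, let $\mathcal{I}$ and $\mathcal{J}$ be ideals on $\omega$, and suppose that $\mathcal{J}$ is countably generated. Then $$\mathrm{core}_{A\bm{x}}(\mathcal{J})=\mathrm{core}_{\bm{x}}(\mathcal{I})\quad\text{for all sequences }\bm{x}\in\ell_\infty$$ if and only if both of the following conditions hold: (L1) $A$ is $(\mathcal{I},\mathcal{J})$-regular; (L2) $\mathcal{J}\text{-}\limsup_{n}\sum_{k\in E}|a_{n,k}|=1$ for all $E\in\mathcal{I}^+$.
   Context: $\omega$ is the set of natural numbers (including $0$). An ideal $\mathcal{I}$ on $\omega$ is a family of subsets of $\omega$ closed under subsets and finite unions; it is always assumed that $\mathcal{I}$ contains the family $\mathrm{Fin}$ of finite subsets of $\omega$ and that $\omega\notin\mathcal{I}$. Write $\mathcal{I}^+:=\mathcal{P}(\omega)\setminus\mathcal{I}$ and $\mathcal{I}^\star:=\{S\subseteq\omega:\omega\setminus S\in\mathcal{I}\}$. An ideal $\mathcal{J}$ on $\omega$ is countably generated if there is a sequence $(Q_k:k\in\omega)$ of subsets of $\omega$ such that, for every $S\subseteq\omega$, $S\in\mathcal{J}$ if and only if $S\subseteq\bigcup_{k\in F}Q_k$ for some finite $F\subseteq\omega$. $\ell_\infty$ is the space of bounded real sequences indexed by $\omega$. For a real sequence $\bm{x}=(x_n:n\in\omega)$, its $\mathcal{I}$-core is $\mathrm{core}_{\bm{x}}(\mathcal{I}):=\bigcap_{S\in\mathcal{I}^\star}\overline{\mathrm{co}}\{x_n:n\in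 S\}$, where $\overline{\mathrm{co}}$ denotes the closed convex hull. A point $\eta\in\mathbf{R}$ is an $\mathcal{I}$-cluster point of $\bm{x}$ if $\{n\in\omega:x_n\in U\}\in\mathcal{I}^+$ for all neighborhoods $U$ of $\eta$; $\Gamma_{\bm{x}}(\mathcal{I})$ denotes the set of $\mathcal{I}$-cluster points. For bounded real $\bm{x}$, $\Gamma_{\bm{x}}(\mathcal{I})$ is nonempty and compact, and one sets $\mathcal{I}\text{-}\limsup\bm{x}:=\max\Gamma_{\bm{x}}(\mathcal{I})$. One writes $\mathcal{I}\text{-}\lim\bm{x}=\eta$ if $\{n\in\omega:x_n\in U\}\in\mathcal{I}^\star$ for all neighborhoods $U$ of $\eta$. $c_b(\mathcal{I})$ is the space of bounded real sequences that are $\mathcal{I}$-convergent to some real number. For an infinite real matrix $A=(a_{n,k}:n,k\in\omega)$ and a real sequence $\bm{x}$, $A\bm{x}:=(A_n\bm{x}:n\in\omega)$ with $A_n\bm{x}:=\sum_{k\in\omega}a_{n,k}x_k$, which is defined if every such series converges to a real number. For spaces $\mathcal{A},\mathcal{B}$ of real sequences, $A\in(\mathcal{A},\mathcal{B})$ means that $A\bm{x}$ is defined and belongs to $\mathcal{B}$ for all $\bm{x}\in\mathcal{A}$. The matrix $A$ is $(\mathcal{I},\mathcal{J})$-regular if $A\in(c_b(\mathcal{I}),c_b(\mathcal{J}))$ and $\mathcal{I}\text{-}\lim\bm{x}=\mathcal{J}\text{-}\lim A\bm{x}$ for all $\bm{x}\in c_b(\mathcal{I})$. *)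

theory Defs
  imports "HOL-Analysis.Analysis"
begin

definition is_ideal :: "nat set set \<Rightarrow> bool" where
  "is_ideal I \<longleftrightarrow>
     (\<forall>S\<in>I. \<forall>T. T \<subseteq> S \<longrightarrow> T \<in> I) \<and>
     (\<forall>S\<in>I. \<forall>T\<in>I. S \<union> T \<in> I) \<and>
     (\<forall>S. finite S \<longrightarrow> S \<in> I) \<and>
     UNIV \<notin> I"

definition ideal_pos :: "nat set set \<Rightarrow> nat set set" where
  "ideal_pos I = {S. S \<notin> I}"

definition ideal_dual :: "nat set set \<Rightarrow> nat set set" where
  "ideal_dual I = {S. UNIV - S \<in> I}"

definition countably_generated_ideal :: "nat set set \<Rightarrow> bool" where
  "countably_generated_ideal J \<longleftrightarrow>
     (\<exists>Q :: nat \<Rightarrow> nat set. \<forall>S. S \<in> J \<longleftrightarrow> (\<exists>F. finite F \<and> S \<subseteq> (\<Union>k\<in>F. Q k)))"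

definition l_infty :: "(nat \<Rightarrow> real) set" where
  "l_infty = {x. bounded (range x)}"

definition ideal_core :: "nat set set \<Rightarrow> (nat \<Rightarrow> real) \<Rightarrow> real set" where
  "ideal_core I x = (\<Inter>S\<in>ideal_dual I. closure (convex hull (x ` S)))"

definition cluster_points :: "nat set set \<Rightarrow> (nat \<Rightarrow> real) \<Rightarrow> real set" where
  "cluster_points I x =
     {\<eta>. \<forall>U. open U \<longrightarrow> \<eta> \<in> U \<longrightarrow> {n. x n \<in> U} \<in> ideal_pos I}"

text \<open>
  The library's \<^const>\<open>Max\<close> is only meaningful on finite sets, so the maximum of the set of
  cluster points is taken with \<^const>\<open>Greatest\<close>. It exists if \<open>x\<close> is bounded;
  for other \<open>x\<close> the value may be unspecified.
\<close>
definition ideal_limsup :: "nat set set \<Rightarrow> (nat \<Rightarrow> real) \<Rightarrow> real" where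
  "ideal_limsup I x = (GREATEST \<eta>. \<eta> \<in> cluster_points I x)"

definition ideal_tendsto :: "nat set set \<Rightarrow> (nat \<Rightarrow> real) \<Rightarrow> real \<Rightarrow> bool" where
  "ideal_tendsto I x \<eta> \<longleftrightarrow>
     (\<forall>U. open U \<longrightarrow> \<eta> \<in> U \<longrightarrow> {n. x n \<in> U} \<in> ideal_dual I)"

definition c_b :: "nat set set \<Rightarrow> (nat \<Rightarrow> real) set" where
  "c_b I = {x \<in> l_infty. \<exists>\<eta>. ideal_tendsto I x \<eta>}"

definition mat_defined :: "(nat \<Rightarrow> nat \<Rightarrow> real) \<Rightarrow> (nat \<Rightarrow> real) \<Rightarrow> bool" where
  "mat_defined a x \<longleftrightarrow> (\<forall>n. summable (\<lambda>k. a n k * x k))"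

definition mat_app :: "(nat \<Rightarrow> nat \<Rightarrow> real) \<Rightarrow> (nat \<Rightarrow> real) \<Rightarrow> nat \<Rightarrow> real" where
  "mat_app a x n = (\<Sum>k. a n k * x k)"

definition mat_class ::
  "(nat \<Rightarrow> real) set \<Rightarrow> (nat \<Rightarrow> real) set \<Rightarrow> (nat \<Rightarrow> nat \<Rightarrow> real) set" where
  "mat_class X Y = {a. \<forall>x\<in>X. mat_defined a x \<and> mat_app a x \<in> Y}"

text \<open>
  Ideal limits are unique, so the equality of the two limits is expressed by saying that
  the limit of \<open>x\<close> is also the limit of its transform.
\<close>
definition ideal_regular ::
  "nat set set \<Rightarrow> nat set set \<Rightarrow> (nat \<Rightarrow> nat \<Rightarrow> real) \<Rightarrow> bool" where
  "ideal_regular I J a \<longleftrightarrow>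
     a \<in> mat_class (c_b I) (c_b J) \<and>
     (\<forall>x\<in>c_b I. \<forall>\<eta>. ideal_tendsto I x \<eta> \<longrightarrow> ideal_tendsto J (mat_app a x) \<eta>)"

end

theory Submission
  imports Defs
begin

text \<open>
  For bounded sequences, inclusion of a point in the core is a condition on frequent upper and
  lower bounds along the filter dual to the ideal. If (L1) and (L2) hold, then along \<open>J\<close> the row
  sums and the absolute row sums both have upper limit 1, so negative entries are negligible and
  \<open>A\<close> averages asymptotically; sets in \<open>I\<close> carry no mass, while every \<open>I\<close>-positive set carries
  almost all the mass frequently. This transports the upper bounds of \<open>x\<close> to \<open>A x\<close> and back.
  Conversely, equality of cores for indicators gives the lower bound in (L2). The upper bound is
  a gliding hump argument: if the absolute row sums exceed some \<open>c > 1\<close> on a \<open>J\<close>-positive set,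
  countable generation yields a sequence in that set having only finitely many terms in each
  member of \<open>J\<close>, and a sequence of signs \<open>x\<close> matched to these rows has a point above 1 in the
  core of \<open>A x\<close>.
\<close>

section \<open>The filter dual to an ideal\<close>

text \<open>With this encoding, membership in \<open>ideal_dual\<close> is \<open>eventually\<close>
  and positivity is \<open>frequently\<close>, so filter limits apply. \<open>Abs_filter\<close> is
  meaningful only for a genuine filter; \<open>is_ideal\<close> guarantees one, and
  \<open>UNIV \<notin> I\<close> makes it proper.\<close>

definition ideal_filter :: "nat set set \<Rightarrow> nat filter" where
  "ideal_filter I = Abs_filter (\<lambda>P. {n. \<not> P n} \<in> I)"

lemma eventually_ideal_filter:
  assumes "is_ideal I"
  shows "eventually P (ideal_filter I) \<longleftrightarrow> {n. \<not> P n} \<in> I"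
  unfolding ideal_filter_def
proof (rule eventually_Abs_filter, unfold_locales)
  show "{n. \<not> True} \<in> I"
    using assms by (simp add: is_ideal_def)
next
  fix P Q :: "nat \<Rightarrow> bool"
  assume "{n. \<not> P n} \<in> I" "{n. \<not> Q n} \<in> I"
  then have "{n. \<not> P n} \<union> {n. \<not> Q n} \<in> I"
    using assms by (simp add: is_ideal_def)
  moreover have "{n. \<not> P n} \<union> {n. \<not> Q n} = {n. \<not> (P n \<and> Q n)}"
    by auto
  ultimately show "{n. \<not> (P n \<and> Q n)} \<in> I"
    by simp
next
  fix P Q :: "nat \<Rightarrow> bool"
  assume "\<forall>n. P n \<longrightarrow> Q n" "{n. \<not> P n} \<in> I"
  moreover have "{n. \<not> Q n} \<subseteq> {n. \<not> P n}"
    using \<open>\<forall>n. P n \<longrightarrow> Q n\<close> by auto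
  ultimately show "{n. \<not> Q n} \<in> I"
    using assms unfolding is_ideal_def by blast
qed

lemma frequently_ideal_filter:
  assumes "is_ideal I"
  shows "frequently P (ideal_filter I) \<longleftrightarrow> {n. P n} \<notin> I"
  by (simp add: frequently_def eventually_ideal_filter[OF assms])

lemma ideal_filter_neq_bot:
  assumes "is_ideal I"
  shows "ideal_filter I \<noteq> bot"
  using assms eventually_ideal_filter[OF assms, of "\<lambda>_. False"]
  by (auto simp: is_ideal_def trivial_limit_def)

lemma ideal_tendsto_iff:
  assumes "is_ideal I"
  shows "ideal_tendsto I x l \<longleftrightarrow> (x \<longlongrightarrow> l) (ideal_filter I)"
  by (simp add: ideal_tendsto_def tendsto_def eventually_ideal_filter[OF assms] ideal_dual_def
      Compl_eq_Diff_UNIV[symmetric] Collect_neg_eq)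

lemma in_cluster_points_iff:
  assumes "is_ideal I"
  shows "l \<in> cluster_points I x \<longleftrightarrow>
    (\<forall>U. open U \<longrightarrow> l \<in> U \<longrightarrow> (\<exists>\<^sub>F n in ideal_filter I. x n \<in> U))"
  by (simp add: cluster_points_def ideal_pos_def frequently_ideal_filter[OF assms])

text \<open>A half-line that eventually contains \<open>x\<close> is closed and convex, so it
  contains the core. Conversely, each dual set \<open>S\<close> has a term above
  \<open>y - e\<close> and a term below \<open>y + e\<close>: one of them is within \<open>e\<close>
  of \<open>y\<close>, or they straddle \<open>y\<close> and the hull is an interval.\<close>

lemma in_ideal_core_iff:
  assumes I: "is_ideal I"
  shows "y \<in> ideal_core I x \<longleftrightarrow>
    (\<forall>c<y. \<exists>\<^sub>F n in ideal_filter I. c < x n) \<and> (\<forall>c>y. \<exists>\<^sub>F n in ideal_filter I. x n < c)"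
    (is "?L \<longleftrightarrow> ?up \<and> ?low")
proof
  assume y: ?L
  have hull: "y \<in> C" if "convex C" "closed C" "\<forall>\<^sub>F n in ideal_filter I. x n \<in> C" for C
  proof -
    have "{n. x n \<in> C} \<in> ideal_dual I"
      using that(3) by (simp add: eventually_ideal_filter[OF I] ideal_dual_def
          Compl_eq_Diff_UNIV[symmetric] Collect_neg_eq)
    then have "y \<in> closure (convex hull (x ` {n. x n \<in> C}))"
      using y by (auto simp: ideal_core_def)
    moreover have "closure (convex hull (x ` {n. x n \<in> C})) \<subseteq> C"
      by (intro closure_minimal hull_minimal that) auto
    ultimately show ?thesis
      by auto
  qed
  show "?up \<and> ?low"
    \<comment> \<open>If a frequency condition fails at \<open>c\<close>, then \<open>x\<close>
      eventually stays in a closed half-line that ends at \<open>c\<close> and misses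
      \<open>y\<close>.\<close>
    using hull[of "{..c}" for c] hull[of "{c..}" for c]
    by (force simp: frequently_def not_less)
next
  assume *: "?up \<and> ?low"
  have "y \<in> closure (convex hull (x ` S))" if S: "UNIV - S \<in> I" for S
    unfolding closure_approachable
  proof (intro allI impI)
    fix e :: real
    assume e: "0 < e"
    have evS: "\<forall>\<^sub>F n in ideal_filter I. n \<in> S"
      using S by (simp add: eventually_ideal_filter[OF I] Collect_neg_eq Compl_eq_Diff_UNIV)
    have "\<exists>\<^sub>F n in ideal_filter I. y - e < x n" "\<exists>\<^sub>F n in ideal_filter I. x n < y + e"
      using * e by auto
    from this[THEN frequently_eventually_conj, OF evS]
    have "\<exists>\<^sub>F n in ideal_filter I. n \<in> S \<and> y - e < x n"
      "\<exists>\<^sub>F n in ideal_filter I. n \<in> S \<and> x n < y + e" .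
    from this[THEN frequently_ex]
    obtain i j where ij: "i \<in> S" "y - e < x i" "j \<in> S" "x j < y + e"
      by blast
    then have mem: "x i \<in> convex hull (x ` S)" "x j \<in> convex hull (x ` S)"
      by (auto intro: hull_inc)
    show "\<exists>z\<in>convex hull (x ` S). dist z y < e"
    proof (cases "x i < y + e \<or> y - e < x j")
      case True
      then have "dist (x i) y < e \<or> dist (x j) y < e"
        using ij by (auto simp: dist_real_def abs_less_iff)
      then show ?thesis
        using mem by blast
    next
      case False
      have "is_interval (convex hull (x ` S))"
        by (simp add: is_interval_convex_1)
      then have "y \<in> convex hull (x ` S)"
        by (rule mem_is_interval_1_I[OF _ mem(2) mem(1)]) (use False e in linarith)+
      then show ?thesis
        using e by (intro bexI[of _ y]) auto
    qed
  qed
  then show ?L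
    by (auto simp: ideal_core_def ideal_dual_def)
qed

lemma all_less_uminus_iff:
  fixes y :: real
  shows "(\<forall>c<(- y). P c) \<longleftrightarrow> (\<forall>c>y. P (- c))"
proof (intro iffI allI impI)
  fix c
  assume "\<forall>c>y. P (- c)" "c < - y"
  then show "P c"
    by (auto simp: less_minus_iff[of c y] dest: spec[of _ "- c"])
qed simp

text \<open>Reflection swaps the two frequency conditions, so only upper bounds need a direct
  argument.\<close>

lemma in_ideal_core_uminus_iff:
  assumes "is_ideal I"
  shows "y \<in> ideal_core I x \<longleftrightarrow> - y \<in> ideal_core I (\<lambda>n. - x n)"
  using all_less_uminus_iff[of y "\<lambda>c. \<exists>\<^sub>F n in ideal_filter I. c < - x n"]
    all_less_uminus_iff[of "- y" "\<lambda>c. \<exists>\<^sub>F n in ideal_filter I. c < x n"]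
  by (simp add: in_ideal_core_iff[OF assms] minus_less_iff conj_commute)

section \<open>Upper limits of bounded sequences and points of the core\<close>

text \<open>\<open>L\<close> is the supremum of the levels exceeded frequently; properness of
  \<open>F\<close> puts every lower bound of \<open>x\<close> minus a margin among these
  levels.\<close>

lemma bounded_upper_limit_exists:
  fixes x :: "'a \<Rightarrow> real"
  assumes F: "F \<noteq> bot" and x: "bounded (range x)"
  obtains L where "\<And>c. c < L \<Longrightarrow> \<exists>\<^sub>F n in F. c < x n" "\<And>c. L < c \<Longrightarrow> \<forall>\<^sub>F n in F. x n < c"
proof -
  define C where "C = {c. \<exists>\<^sub>F n in F. c < x n}"
  obtain B where B: "\<And>n. \<bar>x n\<bar> \<le> B"
    using x by (auto simp: bounded_iff)
  have "- B - 1 < x n" for n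
    using B[of n] by auto
  then have "- B - 1 \<in> C"
    using F by (simp add: C_def frequently_const)
  then have ne: "C \<noteq> {}"
    by blast
  have bdd: "c \<le> B" if "c \<in> C" for c
  proof -
    obtain n where "c < x n"
      using \<open>c \<in> C\<close> by (auto simp: C_def dest: frequently_ex)
    then show ?thesis
      using B[of n] by auto
  qed
  then have bdd': "bdd_above C"
    by (rule bdd_aboveI)
  show ?thesis
  proof (rule that)
    fix c
    assume "c < Sup C"
    then obtain c' where "c' \<in> C" "c < c'"
      using less_cSup_iff[OF ne bdd'] by auto
    then show "\<exists>\<^sub>F n in F. c < x n"
      by (auto simp: C_def elim!: frequently_elim1)
  next
    fix c
    assume "Sup C < c"
    \<comment> \<open>Failure of frequent excess gives only a non-strict bound; an intermediate
      level makes it strict at \<open>c\<close>.\<close>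
    then obtain d where d: "Sup C < d" "d < c"
      using dense by blast
    then have "d \<notin> C"
      using cSup_upper[OF _ bdd'] by fastforce
    then have "\<forall>\<^sub>F n in F. x n \<le> d"
      by (simp add: C_def frequently_def not_less)
    then show "\<forall>\<^sub>F n in F. x n < c"
      by eventually_elim (use d in auto)
  qed
qed

text \<open>Frequent excess of \<open>L - e\<close> and eventual smallness below
  \<open>L + e\<close> make \<open>L\<close> a cluster point, while a level between \<open>L\<close>
  and a larger point excludes the latter. Hence \<open>GREATEST\<close> is attained.\<close>

lemma ideal_limsup_eqI:
  assumes I: "is_ideal I"
    and low: "\<And>c. c < L \<Longrightarrow> \<exists>\<^sub>F n in ideal_filter I. c < x n"
    and up: "\<And>c. L < c \<Longrightarrow> \<forall>\<^sub>F n in ideal_filter I. x n < c"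
  shows "ideal_limsup I x = L"
  unfolding ideal_limsup_def
proof (rule Greatest_equality)
  show "L \<in> cluster_points I x"
    unfolding in_cluster_points_iff[OF I]
  proof (intro allI impI)
    fix U :: "real set"
    assume "open U" "L \<in> U"
    then obtain e where e: "e > 0" "ball L e \<subseteq> U"
      using open_contains_ball by blast
    have "\<forall>\<^sub>F n in ideal_filter I. x n < L + e"
      using e by (intro up) auto
    moreover have "\<exists>\<^sub>F n in ideal_filter I. L - e < x n"
      using e by (intro low) auto
    ultimately have "\<exists>\<^sub>F n in ideal_filter I. x n < L + e \<and> L - e < x n"
      by (intro frequently_eventually_conj)
    then show "\<exists>\<^sub>F n in ideal_filter I. x n \<in> U"
      by (rule frequently_elim1) (use e in \<open>auto simp: subset_iff dist_real_def\<close>)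
  qed
next
  fix y
  assume y: "y \<in> cluster_points I x"
  show "y \<le> L"
  proof (rule ccontr)
    assume "\<not> y \<le> L"
    then obtain c where c: "L < c" "c < y"
      using dense not_le by blast
    then have "\<exists>\<^sub>F n in ideal_filter I. x n \<in> {c<..}"
      using y unfolding in_cluster_points_iff[OF I] by (metis greaterThan_iff open_greaterThan)
    moreover have "\<forall>\<^sub>F n in ideal_filter I. x n \<notin> {c<..}"
      using up[OF c(1)] by (rule eventually_mono) auto
    ultimately show False
      by (simp add: frequently_def)
  qed
qed

lemma ideal_limsup_bounded:
  assumes I: "is_ideal I" and x: "bounded (range x)"
  shows "c < ideal_limsup I x \<Longrightarrow> \<exists>\<^sub>F n in ideal_filter I. c < x n"
    and "ideal_limsup I x < c \<Longrightarrow> \<forall>\<^sub>F n in ideal_filter I. x n < c"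
proof -
  obtain L where L: "\<And>c. c < L \<Longrightarrow> \<exists>\<^sub>F n in ideal_filter I. c < x n"
    "\<And>c. L < c \<Longrightarrow> \<forall>\<^sub>F n in ideal_filter I. x n < c"
    by (rule bounded_upper_limit_exists[OF ideal_filter_neq_bot[OF I] x]) blast
  then have "ideal_limsup I x = L"
    by (rule ideal_limsup_eqI[OF I])
  with L show "c < ideal_limsup I x \<Longrightarrow> \<exists>\<^sub>F n in ideal_filter I. c < x n"
    "ideal_limsup I x < c \<Longrightarrow> \<forall>\<^sub>F n in ideal_filter I. x n < c"
    by simp_all
qed

text \<open>The upper limit itself lies in the core: its lower frequency condition follows from the
  eventual upper bound, since the filter is proper. This turns frequent large values into core
  points.\<close>

lemma ideal_core_above:
  assumes I: "is_ideal I" and x: "bounded (range x)"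
    and freq: "\<exists>\<^sub>F n in ideal_filter I. c \<le> x n"
  obtains y where "c \<le> y" "y \<in> ideal_core I x"
proof -
  note F = ideal_filter_neq_bot[OF I]
  obtain L where L: "\<And>c. c < L \<Longrightarrow> \<exists>\<^sub>F n in ideal_filter I. c < x n"
    "\<And>c. L < c \<Longrightarrow> \<forall>\<^sub>F n in ideal_filter I. x n < c"
    by (rule bounded_upper_limit_exists[OF F x]) blast
  have "c \<le> L"
  proof (rule ccontr)
    assume "\<not> c \<le> L"
    then have "\<forall>\<^sub>F n in ideal_filter I. x n < c"
      by (intro L) auto
    with freq show False
      by (simp add: frequently_def not_le)
  qed
  moreover have "L \<in> ideal_core I x"
    using L F by (auto simp: in_ideal_core_iff[OF I] intro: eventually_frequently)
  ultimately show ?thesis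
    using that by blast
qed

section \<open>Convergence and cores inside a singleton\<close>

text \<open>Frequent values at or beyond some \<open>c \<noteq> l\<close> would produce a core point
  on the far side of \<open>c\<close>; the lower side is the upper side for
  \<open>- x\<close>.\<close>

lemma tendsto_if_ideal_core_subset_singleton:
  assumes I: "is_ideal I" and x: "bounded (range x)" and core: "ideal_core I x \<subseteq> {l}"
  shows "(x \<longlongrightarrow> l) (ideal_filter I)"
proof (rule order_tendstoI)
  fix c
  assume c: "l < c"
  have "\<not> (\<exists>\<^sub>F n in ideal_filter I. c \<le> x n)"
  proof
    assume "\<exists>\<^sub>F n in ideal_filter I. c \<le> x n"
    then obtain y where "c \<le> y" "y \<in> ideal_core I x"
      by (rule ideal_core_above[OF I x])
    with core c show False
      by auto
  qed
  then show "\<forall>\<^sub>F n in ideal_filter I. x n < c"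
    by (simp add: frequently_def not_le)
next
  fix c
  assume c: "c < l"
  have x': "bounded (range (\<lambda>n. - x n))"
    using x by (simp add: bounded_iff)
  have "\<not> (\<exists>\<^sub>F n in ideal_filter I. - c \<le> - x n)"
  proof
    assume "\<exists>\<^sub>F n in ideal_filter I. - c \<le> - x n"
    then obtain y where y: "- c \<le> y" "y \<in> ideal_core I (\<lambda>n. - x n)"
      by (rule ideal_core_above[OF I x'])
    then have "- y \<in> ideal_core I x"
      using in_ideal_core_uminus_iff[OF I, of "- y" x] by simp
    with core c y(1) show False
      by auto
  qed
  then show "\<forall>\<^sub>F n in ideal_filter I. c < x n"
    by (simp add: frequently_def not_le)
qed

lemma ideal_core_subset_singleton_if_tendsto:
  assumes I: "is_ideal I" and x: "(x \<longlongrightarrow> l) (ideal_filter I)"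
  shows "ideal_core I x \<subseteq> {l}"
proof
  fix y
  assume y: "y \<in> ideal_core I x"
  have "\<not> y < l"
  proof
    assume "y < l"
    then obtain c where c: "y < c" "c < l"
      using dense by blast
    then have "\<exists>\<^sub>F n in ideal_filter I. x n < c"
      using y by (auto simp: in_ideal_core_iff[OF I])
    moreover have "\<forall>\<^sub>F n in ideal_filter I. \<not> x n < c"
      using order_tendstoD(1)[OF x c(2)] by (rule eventually_mono) auto
    ultimately show False
      by (simp add: frequently_def)
  qed
  moreover have "\<not> l < y"
  proof
    assume "l < y"
    then obtain c where c: "l < c" "c < y"
      using dense by blast
    then have "\<exists>\<^sub>F n in ideal_filter I. c < x n"
      using y by (auto simp: in_ideal_core_iff[OF I])
    moreover have "\<forall>\<^sub>F n in ideal_filter I. \<not> c < x n"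
      using order_tendstoD(2)[OF x c(1)] by (rule eventually_mono) auto
    ultimately show False
      by (simp add: frequently_def)
  qed
  ultimately show "y \<in> {l}"
    by auto
qed

section \<open>Matrices on bounded sequences\<close>

lemma mat_class_l_inftyD:
  assumes "a \<in> mat_class l_infty l_infty" "bounded (range x)"
  shows "summable (\<lambda>k. a n k * x k)" "bounded (range (mat_app a x))"
  using assms by (auto simp: mat_class_def l_infty_def mat_defined_def)

text \<open>The signs of the row form a bounded test sequence. It depends on \<open>n\<close>, so no
  bound uniform in \<open>n\<close> results yet.\<close>

lemma mat_class_abs_summable:
  assumes "a \<in> mat_class l_infty l_infty"
  shows "summable (\<lambda>k. \<bar>a n k\<bar>)"
proof -
  have "bounded (range (\<lambda>k. sgn (a n k)))"
    by (auto simp: bounded_iff sgn_if intro!: exI[of _ 1])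
  from mat_class_l_inftyD(1)[OF assms this, of n] show ?thesis
    by (simp add: abs_sgn)
qed

lemma abs_summable_mult_bounded:
  fixes b x :: "nat \<Rightarrow> real"
  assumes "summable (\<lambda>k. \<bar>b k\<bar>)" "\<And>k. \<bar>x k\<bar> \<le> M"
  shows "summable (\<lambda>k. b k * x k)"
proof (rule summable_comparison_test')
  show "summable (\<lambda>k. \<bar>b k\<bar> * M)"
    by (intro summable_mult2 assms)
  show "norm (b k * x k) \<le> \<bar>b k\<bar> * M" for k
    by (simp add: abs_mult mult_left_mono assms)
qed

text \<open>Links the unordered sums over \<open>E\<close> in (L2) with the indicator-weighted
  series used in all estimates.\<close>

lemma infsum_abs_eq_suminf:
  fixes b :: "nat \<Rightarrow> real"
  assumes "summable (\<lambda>k. \<bar>b k\<bar>)"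
  shows "(\<Sum>\<^sub>\<infinity>k\<in>E. \<bar>b k\<bar>) = (\<Sum>k. \<bar>b k\<bar> * indicator E k)"
proof -
  have "summable (\<lambda>k. \<bar>b k\<bar> * indicator E k)"
    by (rule abs_summable_mult_bounded[where M = 1])
      (use assms in \<open>auto simp: indicator_def\<close>)
  then have "((\<lambda>k. \<bar>b k\<bar> * indicator E k) has_sum (\<Sum>k. \<bar>b k\<bar> * indicator E k)) UNIV"
    by (intro norm_summable_imp_has_sum summable_sums) (auto simp: abs_mult)
  then have "(\<Sum>\<^sub>\<infinity>k. \<bar>b k\<bar> * indicator E k) = (\<Sum>k. \<bar>b k\<bar> * indicator E k)"
    by (rule infsumI)
  moreover have "(\<Sum>\<^sub>\<infinity>k\<in>E. \<bar>b k\<bar>) = (\<Sum>\<^sub>\<infinity>k. \<bar>b k\<bar> * indicator E k)"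
    by (rule infsum_cong_neutral) (auto simp: indicator_def)
  ultimately show ?thesis
    by simp
qed

section \<open>Gliding hump and uniformly bounded row sums\<close>

text \<open>The columns split into consecutive blocks. The row chosen at the start \<open>m\<close>
  of a block has all but \<open>\<delta> / 2\<close> of its mass before the end of the block, and
  \<open>x\<close> copies its signs there. Columns outside the block cost at most their mass.
  \<open>P\<close> stays abstract because the construction serves twice: for bounded rows and for
  the upper bound in (L2).\<close>

lemma gliding_hump:
  fixes a :: "nat \<Rightarrow> nat \<Rightarrow> real" and P :: "nat \<Rightarrow> nat \<Rightarrow> nat \<Rightarrow> bool"
  assumes a: "\<And>n. summable (\<lambda>k. \<bar>a n k\<bar>)" and "0 < \<delta>" and P: "\<And>j m. \<exists>n. P j m n"
  obtains x where "\<And>k. \<bar>x k\<bar> \<le> 1"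
    "\<And>j. \<exists>m n. P j m n \<and> (\<Sum>k. \<bar>a n k\<bar>) - 2 * (\<Sum>k<m. \<bar>a n k\<bar>) - \<delta> \<le> mat_app a x n"
proof -
  obtain N where N: "\<And>j m. P j m (N j m)"
    using P by metis
  have "\<exists>T. \<forall>m\<ge>T. (\<Sum>k. \<bar>a n k\<bar>) - \<delta> / 2 < (\<Sum>k<m. \<bar>a n k\<bar>)" for n
    using order_tendstoD(1)[OF summable_LIMSEQ[OF a[of n]], of "(\<Sum>k. \<bar>a n k\<bar>) - \<delta> / 2"] \<open>0 < \<delta>\<close>
    by (simp add: eventually_sequentially)
  then obtain T where T: "\<And>n m. T n \<le> m \<Longrightarrow> (\<Sum>k. \<bar>a n k\<bar>) - \<delta> / 2 < (\<Sum>k<m. \<bar>a n k\<bar>)"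
    by metis
  \<comment> \<open>\<open>M j\<close> is the start of block \<open>j\<close>; \<open>Suc m\<close>
    keeps blocks nonempty, and \<open>T\<close> makes the block long enough for the row chosen at
    \<open>m\<close>.\<close>
  define M where "M = rec_nat 0 (\<lambda>j m. max (Suc m) (T (N j m)))"
  have M_Suc: "M (Suc j) = max (Suc (M j)) (T (N j (M j)))" for j
    by (simp add: M_def)
  have "strict_mono M"
    by (simp add: strict_mono_Suc_iff M_Suc less_max_iff_disj)
  \<comment> \<open>The \<open>LEAST\<close> recovers the index of the block containing
    \<open>k\<close>.\<close>
  define x where "x k = sgn (a (let j = LEAST j. k < M (Suc j) in N j (M j)) k)" for k
  have x_le: "\<bar>x k\<bar> \<le> 1" for k
    by (simp add: x_def sgn_if)
  have x_block: "x k = sgn (a (N j (M j)) k)" if "M j \<le> k" "k < M (Suc j)" for j k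
  proof -
    have "(LEAST j. k < M (Suc j)) = j"
    proof (rule Least_equality)
      fix i
      assume "k < M (Suc i)"
      with that have "M j < M (Suc i)"
        by simp
      then show "j \<le> i"
        using strict_mono_less[OF \<open>strict_mono M\<close>] by simp
    qed (use that in simp)
    then show ?thesis
      by (simp add: x_def)
  qed
  show ?thesis
  proof (rule that)
    fix j
    define m m' n where "m = M j" and "m' = M (Suc j)" and "n = N j (M j)"
    have fin: "(\<lambda>k. \<bar>a n k\<bar> * indicator {..<r} k) sums (\<Sum>k<r. \<bar>a n k\<bar>)" for r
      using sums_finite[of "{..<r}" "\<lambda>k. \<bar>a n k\<bar> * indicator {..<r} k"]
      by (simp add: indicator_def)
    \<comment> \<open>This minorant equals \<open>\<bar>a n k\<bar>\<close> on the block and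
      \<open>- \<bar>a n k\<bar>\<close> elsewhere.\<close>
    have "(\<lambda>k. 2 * (\<bar>a n k\<bar> * indicator {..<m'} k) - 2 * (\<bar>a n k\<bar> * indicator {..<m} k) - \<bar>a n k\<bar>)
        sums (2 * (\<Sum>k<m'. \<bar>a n k\<bar>) - 2 * (\<Sum>k<m. \<bar>a n k\<bar>) - (\<Sum>k. \<bar>a n k\<bar>))"
      by (intro sums_diff sums_mult fin summable_sums a)
    moreover have "(\<lambda>k. a n k * x k) sums mat_app a x n"
      unfolding mat_app_def by (intro summable_sums abs_summable_mult_bounded[OF a x_le])
    moreover have "2 * (\<bar>a n k\<bar> * indicator {..<m'} k) - 2 * (\<bar>a n k\<bar> * indicator {..<m} k) - \<bar>a n k\<bar>
        \<le> a n k * x k" for k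
    proof (cases "m \<le> k \<and> k < m'")
      case True
      then show ?thesis
        by (simp add: x_block[of j k] m_def m'_def n_def abs_sgn)
    next
      case False
      have "\<bar>a n k * x k\<bar> \<le> \<bar>a n k\<bar>"
        using x_le[of k] by (simp add: abs_mult mult_left_le)
      moreover have "m < m'"
        using \<open>strict_mono M\<close> by (simp add: m_def m'_def strict_mono_less)
      ultimately show ?thesis
        using False by (auto simp: indicator_def)
    qed
    ultimately have "2 * (\<Sum>k<m'. \<bar>a n k\<bar>) - 2 * (\<Sum>k<m. \<bar>a n k\<bar>) - (\<Sum>k. \<bar>a n k\<bar>) \<le> mat_app a x n"
      by (rule sums_le[rotated])
    moreover have "(\<Sum>k. \<bar>a n k\<bar>) - \<delta> / 2 < (\<Sum>k<m'. \<bar>a n k\<bar>)"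
      by (rule T) (simp add: m'_def M_Suc n_def)
    ultimately have "(\<Sum>k. \<bar>a n k\<bar>) - 2 * (\<Sum>k<m. \<bar>a n k\<bar>) - \<delta> \<le> mat_app a x n"
      by simp
    moreover have "P j m n"
      by (simp add: N m_def n_def)
    ultimately show "\<exists>m n. P j m n \<and>
        (\<Sum>k. \<bar>a n k\<bar>) - 2 * (\<Sum>k<m. \<bar>a n k\<bar>) - \<delta> \<le> mat_app a x n"
      by blast
  qed (rule x_le)
qed

text \<open>Unit sequences bound each column, hence every fixed finite head of the rows uniformly in
  \<open>n\<close>. Unbounded row sums would then leave arbitrarily large humps, and one bounded
  \<open>x\<close> would have an unbounded transform.\<close>

lemma mat_class_rows_bounded:
  assumes a: "a \<in> mat_class l_infty l_infty"
  obtains B where "\<And>n. (\<Sum>k. \<bar>a n k\<bar>) \<le> B"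
proof (rule ccontr)
  note rows = mat_class_abs_summable[OF a]
  assume "\<not> thesis"
  then have unbounded: "\<exists>n. B < (\<Sum>k. \<bar>a n k\<bar>)" for B
    using that by (meson not_le)
  have "\<exists>C. \<forall>n. \<bar>a n k\<bar> \<le> C" for k
  proof -
    have "bounded (range (indicator {k} :: nat \<Rightarrow> real))"
      by (auto simp: bounded_iff indicator_def intro!: exI[of _ 1])
    then have "bounded (range (mat_app a (indicator {k})))"
      by (rule mat_class_l_inftyD(2)[OF a])
    moreover have "mat_app a (indicator {k}) n = a n k" for n
      using suminf_finite[of "{k}" "\<lambda>i. a n i * indicator {k} i"]
      by (simp add: mat_app_def)
    ultimately show ?thesis
      by (auto simp: bounded_iff)
  qed
  then obtain C where C: "\<And>n k. \<bar>a n k\<bar> \<le> C k"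
    by metis
  have "\<exists>n. real j \<le> (\<Sum>k. \<bar>a n k\<bar>) - 2 * (\<Sum>k<m. \<bar>a n k\<bar>)" for j m
  proof -
    obtain n where "real j + 2 * (\<Sum>k<m. C k) < (\<Sum>k. \<bar>a n k\<bar>)"
      using unbounded by blast
    moreover have "(\<Sum>k<m. \<bar>a n k\<bar>) \<le> (\<Sum>k<m. C k)"
      by (intro sum_mono C)
    ultimately show ?thesis
      by (intro exI[of _ n]) simp
  qed
  then obtain x where
    x: "\<And>k. \<bar>x k\<bar> \<le> 1" and hump: "\<And>j. \<exists>m n. real j \<le> (\<Sum>k. \<bar>a n k\<bar>) - 2 * (\<Sum>k<m. \<bar>a n k\<bar>) \<and>
      (\<Sum>k. \<bar>a n k\<bar>) - 2 * (\<Sum>k<m. \<bar>a n k\<bar>) - 1 \<le> mat_app a x n"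
    by (rule gliding_hump[where a = a and P =
          "\<lambda>j m n. real j \<le> (\<Sum>k. \<bar>a n k\<bar>) - 2 * (\<Sum>k<m. \<bar>a n k\<bar>)", OF rows zero_less_one]) blast
  have "bounded (range x)"
    using x by (auto simp: bounded_iff)
  then have "bounded (range (mat_app a x))"
    by (rule mat_class_l_inftyD(2)[OF a])
  then obtain D where D: "\<And>n. \<bar>mat_app a x n\<bar> \<le> D"
    by (auto simp: bounded_iff)
  obtain j :: nat where "D + 1 < real j"
    using reals_Archimedean2 by blast
  moreover obtain m n where "real j \<le> (\<Sum>k. \<bar>a n k\<bar>) - 2 * (\<Sum>k<m. \<bar>a n k\<bar>)"
    "(\<Sum>k. \<bar>a n k\<bar>) - 2 * (\<Sum>k<m. \<bar>a n k\<bar>) - 1 \<le> mat_app a x n"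
    using hump[of j] by blast
  ultimately show False
    using D[of n] by auto
qed

lemma bounded_row_sums:
  assumes a: "a \<in> mat_class l_infty l_infty"
  shows "bounded (range (\<lambda>n. \<Sum>k. \<bar>a n k\<bar> * indicator E k))"
proof -
  note rows = mat_class_abs_summable[OF a]
  obtain B where B: "\<And>n. (\<Sum>k. \<bar>a n k\<bar>) \<le> B"
    using mat_class_rows_bounded[OF a] by blast
  have ind: "summable (\<lambda>k. \<bar>a n k\<bar> * indicator E k)" for n
    by (rule abs_summable_mult_bounded[where M = 1]) (use rows in \<open>auto simp: indicator_def\<close>)
  have "(\<Sum>k. \<bar>a n k\<bar> * indicator E k) \<le> (\<Sum>k. \<bar>a n k\<bar>)" for n
    by (intro suminf_le ind rows) (auto simp: indicator_def)
  moreover have "0 \<le> (\<Sum>k. \<bar>a n k\<bar> * indicator E k)" for n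
    by (intro suminf_nonneg ind) auto
  ultimately show ?thesis
    using B by (auto simp: bounded_iff intro!: exI[of _ B] order.trans[OF _ B])
qed

text \<open>Split \<open>b k * x k\<close> into \<open>c * b k\<close> and
  \<open>b k * (x k - c)\<close>. On \<open>E\<close> only negative entries lose, at most
  \<open>K\<close> times the negative part \<open>(\<bar>b k\<bar> - b k) / 2\<close>; off
  \<open>E\<close> the loss is at most \<open>K * \<bar>b k\<bar>\<close>.\<close>

lemma weighted_sum_lower_bound:
  fixes b x :: "nat \<Rightarrow> real"
  assumes b: "summable (\<lambda>k. \<bar>b k\<bar>)"
    and x: "\<And>k. \<bar>x k - c\<bar> \<le> K" and E: "\<And>k. k \<in> E \<Longrightarrow> c \<le> x k"
  shows "c * (\<Sum>k. b k) - K * (((\<Sum>k. \<bar>b k\<bar>) - (\<Sum>k. b k)) / 2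
    + ((\<Sum>k. \<bar>b k\<bar>) - (\<Sum>k. \<bar>b k\<bar> * indicator E k))) \<le> (\<Sum>k. b k * x k)"
proof (rule sums_le)
  have b': "summable b"
    using b by (rule summable_rabs_cancel)
  have ind: "summable (\<lambda>k. \<bar>b k\<bar> * indicator E k)"
    by (rule abs_summable_mult_bounded[where M = 1]) (use b in \<open>auto simp: indicator_def\<close>)
  show "(\<lambda>k. c * b k - K * ((\<bar>b k\<bar> - b k) / 2 + (\<bar>b k\<bar> - \<bar>b k\<bar> * indicator E k))) sums
    (c * (\<Sum>k. b k) - K * (((\<Sum>k. \<bar>b k\<bar>) - (\<Sum>k. b k)) / 2
    + ((\<Sum>k. \<bar>b k\<bar>) - (\<Sum>k. \<bar>b k\<bar> * indicator E k))))"
    by (intro sums_diff sums_mult sums_add sums_divide summable_sums b b' ind)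
  have "\<bar>x k\<bar> \<le> \<bar>c\<bar> + K" for k
    using x[of k] by linarith
  then show "(\<lambda>k. b k * x k) sums (\<Sum>k. b k * x k)"
    by (intro summable_sums abs_summable_mult_bounded[OF b])
  show "c * b k - K * ((\<bar>b k\<bar> - b k) / 2 + (\<bar>b k\<bar> - \<bar>b k\<bar> * indicator E k)) \<le> b k * x k" for k
  proof -
    have K: "0 \<le> K"
      using x[of 0] by linarith
    have lower: "- (\<bar>b k\<bar> * K) \<le> b k * (x k - c)"
      using mult_left_mono[OF x[of k], of "\<bar>b k\<bar>"] by (simp add: abs_mult[symmetric] abs_le_iff)
    have "- (K * ((\<bar>b k\<bar> - b k) / 2 + (\<bar>b k\<bar> - \<bar>b k\<bar> * indicator E k))) \<le> b k * (x k - c)"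
    proof (cases "k \<in> E")
      case True
      show ?thesis
      proof (cases "0 \<le> b k")
        case True
        then show ?thesis
          using \<open>k \<in> E\<close> E[of k] by simp
      next
        case False
        then show ?thesis
          using \<open>k \<in> E\<close> lower by (simp add: mult.commute)
      qed
    next
      case False
      have "0 \<le> K * ((\<bar>b k\<bar> - b k) / 2)"
        using K by (intro mult_nonneg_nonneg) auto
      then show ?thesis
        using False lower by (simp add: distrib_left mult.commute)
    qed
    then show ?thesis
      by (simp add: algebra_simps)
  qed
qed

section \<open>Sufficiency\<close>

text \<open>The test sequences are the constant 1 and the indicator of a set in \<open>I\<close>,
  which tends to 0 along \<open>I\<close>.\<close>

lemma regular_row_sums:
  assumes I: "is_ideal I" and J: "is_ideal J" and reg: "ideal_regular I J a"
  shows "((\<lambda>n. \<Sum>k. a n k) \<longlongrightarrow> 1) (ideal_filter J)"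
    and "S \<in> I \<Longrightarrow> ((\<lambda>n. \<Sum>k. a n k * indicator S k) \<longlongrightarrow> 0) (ideal_filter J)"
proof -
  have *: "(mat_app a x \<longlongrightarrow> l) (ideal_filter J)"
    if "bounded (range x)" "(x \<longlongrightarrow> l) (ideal_filter I)" for x l
    using reg that by (auto simp: ideal_regular_def c_b_def l_infty_def
        ideal_tendsto_iff[OF I, abs_def] ideal_tendsto_iff[OF J, abs_def])
  have "(mat_app a (\<lambda>_. 1) \<longlongrightarrow> 1) (ideal_filter J)"
    by (intro *) auto
  then show "((\<lambda>n. \<Sum>k. a n k) \<longlongrightarrow> 1) (ideal_filter J)"
    by (simp add: mat_app_def[abs_def])
  assume "S \<in> I"
  then have "\<forall>\<^sub>F k in ideal_filter I. indicator S k = (0::real)"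
    by (simp add: eventually_ideal_filter[OF I] indicator_def)
  then have "((indicator S :: nat \<Rightarrow> real) \<longlongrightarrow> 0) (ideal_filter I)"
    by (rule tendsto_eventually)
  moreover have "bounded (range (indicator S :: nat \<Rightarrow> real))"
    by (auto simp: bounded_iff indicator_def intro!: exI[of _ 1])
  ultimately have "(mat_app a (indicator S) \<longlongrightarrow> 0) (ideal_filter J)"
    by (intro *)
  then show "((\<lambda>n. \<Sum>k. a n k * indicator S k) \<longlongrightarrow> 0) (ideal_filter J)"
    by (simp add: mat_app_def[abs_def])
qed

text \<open>This is the upper half of the equality of cores; the lower half follows by reflection.
  Since \<open>s\<close> and \<open>t\<close> both tend to 1, the negative mass
  \<open>(t n - s n) / 2\<close> vanishes along \<open>J\<close>.\<close>

lemma frequently_above_iff: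
  fixes x :: "nat \<Rightarrow> real"
  assumes a: "a \<in> mat_class l_infty l_infty" and I: "is_ideal I" and J: "is_ideal J"
    and reg: "ideal_regular I J a"
    and L2: "\<And>E. E \<notin> I \<Longrightarrow> ideal_limsup J (\<lambda>n. \<Sum>k. \<bar>a n k\<bar> * indicator E k) = 1"
    and x: "bounded (range x)"
  shows "(\<forall>c<y. \<exists>\<^sub>F n in ideal_filter J. c < mat_app a x n) \<longleftrightarrow>
    (\<forall>c<y. \<exists>\<^sub>F k in ideal_filter I. c < x k)"
proof -
  note rows = mat_class_abs_summable[OF a]
  define s t where "s n = (\<Sum>k. a n k)" and "t n = (\<Sum>k. \<bar>a n k\<bar>)" for n
  have s: "(s \<longlongrightarrow> 1) (ideal_filter J)"
    unfolding s_def[abs_def] by (rule regular_row_sums[OF I J reg])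
  have s_le: "s n \<le> t n" for n
    unfolding s_def t_def by (intro suminf_le rows summable_rabs_cancel[OF rows]) simp
  have "UNIV \<notin> I"
    using I by (simp add: is_ideal_def)
  from L2[OF this] have limsup_t: "ideal_limsup J t = 1"
    by (simp add: t_def[abs_def])
  have "bounded (range t)"
    using bounded_row_sums[OF a, of UNIV] by (simp add: t_def[abs_def])
  from ideal_limsup_bounded(2)[OF J this] limsup_t
  \<comment> \<open>The upper bound on \<open>t\<close> is (L2) for the whole of
    \<open>UNIV\<close>; the lower one comes from \<open>s n \<le> t n\<close>.\<close>
  have "\<forall>\<^sub>F n in ideal_filter J. t n < c" if "1 < c" for c
    using that by auto
  moreover have "\<forall>\<^sub>F n in ideal_filter J. c < t n" if "c < 1" for c
    using order_tendstoD(1)[OF s that] by (rule eventually_mono) (meson s_le less_le_trans)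
  ultimately have t: "(t \<longlongrightarrow> 1) (ideal_filter J)"
    by (intro order_tendstoI)
  obtain M where M: "\<And>k. \<bar>x k\<bar> \<le> M"
    using x by (auto simp: bounded_iff)
  show ?thesis
  proof (intro iffI allI impI)
    fix c
    assume Ax: "\<forall>c<y. \<exists>\<^sub>F n in ideal_filter J. c < mat_app a x n" and "c < y"
    show "\<exists>\<^sub>F k in ideal_filter I. c < x k"
    proof (rule ccontr)
      assume "\<not> ?thesis"
      then have S: "{k. c < x k} \<in> I" (is "?S \<in> I")
        by (simp add: frequently_ideal_filter[OF I])
      define r where "r n = (\<Sum>k. a n k * indicator ?S k)" for n
      have r: "(r \<longlongrightarrow> 0) (ideal_filter J)"
        unfolding r_def[abs_def] by (rule regular_row_sums(2)[OF I J reg S])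
      define K where "K = \<bar>c\<bar> + M"
      have K: "\<bar>- x k - - c\<bar> \<le> K" for k
        using M[of k] by (simp add: K_def)
      have K0: "0 \<le> K"
        using K[of 0] by linarith
      have bound: "mat_app a x n \<le> c * s n + K * ((t n - s n) / 2 + (r n + (t n - s n)))" for n
      proof -
        define V where "V = K * ((t n - s n) / 2 + (t n - (\<Sum>k. \<bar>a n k\<bar> * indicator (- ?S) k)))"
        define W where "W = K * ((t n - s n) / 2 + (r n + (t n - s n)))"
        have sS: "summable (\<lambda>k. a n k * indicator S k)" for S
          by (rule abs_summable_mult_bounded[OF rows, where M = 1]) (auto simp: indicator_def)
        have sS': "summable (\<lambda>k. \<bar>a n k\<bar> * indicator S k)" for S
          by (rule abs_summable_mult_bounded[where M = 1]) (use rows in \<open>auto simp: indicator_def\<close>)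
        \<comment> \<open>Regularity controls only the signed mass \<open>r n\<close> on
          \<open>?S\<close>; the defect \<open>t n - s n\<close> upgrades this to absolute
          mass.\<close>
        have "t n - (\<Sum>k. \<bar>a n k\<bar> * indicator (- ?S) k) \<le> r n + (t n - s n)"
        proof -
          have "s n - (\<Sum>k. \<bar>a n k\<bar> * indicator (- ?S) k) \<le> r n"
            unfolding s_def r_def
            by (subst suminf_diff[OF summable_rabs_cancel[OF rows] sS'])
              (intro suminf_le summable_diff sS sS' summable_rabs_cancel[OF rows], auto simp: indicator_def)
          then show ?thesis
            by simp
        qed
        then have "V \<le> W"
          unfolding V_def W_def using K0 by (intro mult_left_mono) auto
        moreover have "- c * s n - V \<le> (\<Sum>k. a n k * - x k)"
          unfolding s_def t_def V_def by (rule weighted_sum_lower_bound[OF rows K]) auto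
        moreover have "(\<Sum>k. a n k * - x k) = - mat_app a x n"
          unfolding mat_app_def using suminf_minus[OF mat_class_l_inftyD(1)[OF a x, of n]] by simp
        ultimately show ?thesis
          unfolding W_def[symmetric] by simp
      qed
      have "((\<lambda>n. c * s n + K * ((t n - s n) / 2 + (r n + (t n - s n)))) \<longlongrightarrow>
          c * 1 + K * ((1 - 1) / 2 + (0 + (1 - 1)))) (ideal_filter J)"
        by (intro tendsto_intros s t r) auto
      then have lim: "((\<lambda>n. c * s n + K * ((t n - s n) / 2 + (r n + (t n - s n)))) \<longlongrightarrow> c) (ideal_filter J)"
        by simp
      obtain d where d: "c < d" "d < y"
        using \<open>c < y\<close> dense by blast
      have "\<forall>\<^sub>F n in ideal_filter J. \<not> d < mat_app a x n"
        using order_tendstoD(2)[OF lim d(1)]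
        by (rule eventually_mono) (use le_less_trans[OF bound] less_asym in blast)
      with Ax d show False
        by (auto simp: frequently_def)
    qed
  next
    fix c
    assume xfreq: "\<forall>c<y. \<exists>\<^sub>F k in ideal_filter I. c < x k" and "c < y"
    obtain d where d: "c < d" "d < y"
      using \<open>c < y\<close> dense by blast
    define E where "E = {k. d < x k}"
    define u where "u n = (\<Sum>k. \<bar>a n k\<bar> * indicator E k)" for n
    define K where "K = \<bar>d\<bar> + M"
    have K: "\<bar>x k - d\<bar> \<le> K" for k
      using M[of k] by (simp add: K_def)
    have K0: "0 \<le> K"
      using K[of 0] by linarith
    have "E \<notin> I"
      using xfreq d by (simp add: frequently_ideal_filter[OF I] E_def)
    have bound: "d * s n - K * ((t n - s n) / 2 + (t n - u n)) \<le> mat_app a x n" for n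
      unfolding s_def t_def u_def mat_app_def
      by (rule weighted_sum_lower_bound[OF rows K]) (simp add: E_def)
    \<comment> \<open>The margin \<open>d - c\<close> is shared equally between the convergent terms
      and the mass missing from \<open>E\<close>. The \<open>+ 1\<close> covers \<open>K = 0\<close>
      and makes the estimate strict.\<close>
    define e where "e = (d - c) / (2 * (K + 1))"
    have e: "0 < e" "K * e < (d - c) / 2"
      using d K0 by (auto simp: e_def field_simps)
    \<comment> \<open>\<open>u\<close> need not converge, so the limit is taken with 1 in its place;
      the correction \<open>K * (1 - u n)\<close> is small only frequently.\<close>
    have "((\<lambda>n. d * s n - K * ((t n - s n) / 2 + (t n - 1))) \<longlongrightarrow>
        d * 1 - K * ((1 - 1) / 2 + (1 - 1))) (ideal_filter J)"
      by (intro tendsto_intros s t) auto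
    then have lim: "((\<lambda>n. d * s n - K * ((t n - s n) / 2 + (t n - 1))) \<longlongrightarrow> d) (ideal_filter J)"
      by simp
    have "\<forall>\<^sub>F n in ideal_filter J. (c + d) / 2 < d * s n - K * ((t n - s n) / 2 + (t n - 1))"
      using order_tendstoD(1)[OF lim, of "(c + d) / 2"] d by simp
    moreover have "\<exists>\<^sub>F n in ideal_filter J. 1 - e < u n"
      unfolding u_def[abs_def]
      using ideal_limsup_bounded(1)[OF J bounded_row_sums[OF a]] L2[OF \<open>E \<notin> I\<close>] e by simp
    ultimately have "\<exists>\<^sub>F n in ideal_filter J. 
        (c + d) / 2 < d * s n - K * ((t n - s n) / 2 + (t n - 1)) \<and> 1 - e < u n"
      by (intro frequently_eventually_conj)
    then show "\<exists>\<^sub>F n in ideal_filter J. c < mat_app a x n"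
    proof (rule frequently_elim1)
      fix n
      assume n: "(c + d) / 2 < d * s n - K * ((t n - s n) / 2 + (t n - 1)) \<and> 1 - e < u n"
      then have "K * (1 - u n) \<le> K * e"
        using K0 by (intro mult_left_mono) auto
      then have "K * (1 - u n) < (d - c) / 2"
        using e by simp
      moreover have "d * s n - K * ((t n - s n) / 2 + (t n - u n)) =
          d * s n - K * ((t n - s n) / 2 + (t n - 1)) - K * (1 - u n)"
        by (simp add: algebra_simps)
      ultimately show "c < mat_app a x n"
        using bound[of n] n by (simp add: field_simps)
    qed
  qed
qed

section \<open>Necessity\<close>

text \<open>Convergence of \<open>x\<close> confines its core to a singleton; the equal core of the
  bounded sequence \<open>mat_app a x\<close> then forces convergence to the same limit.\<close>

lemma regular_if_ideal_core_eq:
  assumes a: "a \<in> mat_class l_infty l_infty" and I: "is_ideal I" and J: "is_ideal J"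
    and core: "\<And>x. bounded (range x) \<Longrightarrow> ideal_core J (mat_app a x) = ideal_core I x"
  shows "ideal_regular I J a"
proof -
  have "ideal_tendsto J (mat_app a x) l" if "bounded (range x)" "ideal_tendsto I x l" for x l
  proof -
    have "ideal_core I x \<subseteq> {l}"
      using that ideal_core_subset_singleton_if_tendsto[OF I] by (simp add: ideal_tendsto_iff[OF I])
    then show ?thesis
      unfolding ideal_tendsto_iff[OF J] using core[OF that(1)]
      by (intro tendsto_if_ideal_core_subset_singleton[OF J] mat_class_l_inftyD[OF a that(1)]) simp
  qed
  then show ?thesis
    using mat_class_l_inftyD[OF a]
    by (force simp: ideal_regular_def mat_class_def c_b_def l_infty_def mat_defined_def)
qed

text \<open>Finite unions of initial generators are increasing, so a single index suffices to cover
  a member of \<open>J\<close>.\<close>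

lemma countably_generated_idealE:
  assumes J: "is_ideal J" and "countably_generated_ideal J"
  obtains Q :: "nat \<Rightarrow> nat set" where "\<And>j. Q j \<in> J" "\<And>S. S \<in> J \<Longrightarrow> \<exists>j. S \<subseteq> Q j"
proof -
  obtain Q :: "nat \<Rightarrow> nat set" where Q: "\<And>S. S \<in> J \<longleftrightarrow> (\<exists>F. finite F \<and> S \<subseteq> (\<Union>k\<in>F. Q k))"
    using assms by (auto simp: countably_generated_ideal_def)
  show ?thesis
  proof (rule that[of "\<lambda>j. \<Union>k\<le>j. Q k"])
    show "(\<Union>k\<le>j. Q k) \<in> J" for j
      using Q by blast
    fix S
    assume "S \<in> J"
    then obtain F where F: "finite F" "S \<subseteq> (\<Union>k\<in>F. Q k)"
      using Q by blast
    \<comment> \<open>For empty \<open>F\<close> the value \<open>Max F\<close> is unspecified, but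
      the inclusion is trivial.\<close>
    then have "F \<subseteq> {..Max F}"
      by auto
    with F show "\<exists>j. S \<subseteq> (\<Union>k\<le>j. Q k)"
      by (intro exI[of _ "Max F"]) blast
  qed
qed

lemma eventually_abs_row_sum_less:
  assumes a: "a \<in> mat_class l_infty l_infty" and I: "is_ideal I" and J: "is_ideal J"
    and gen: "countably_generated_ideal J"
    and core: "\<And>x. bounded (range x) \<Longrightarrow> ideal_core J (mat_app a x) = ideal_core I x"
    and "1 < c"
  shows "\<forall>\<^sub>F n in ideal_filter J. (\<Sum>k. \<bar>a n k\<bar>) < c"
proof (rule ccontr)
  note rows = mat_class_abs_summable[OF a]
  assume "\<not> ?thesis"
  then have large: "\<exists>\<^sub>F n in ideal_filter J. c \<le> (\<Sum>k. \<bar>a n k\<bar>)"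
    by (simp add: frequently_def not_le)
  \<comment> \<open>A hump costs less than \<open>2 * \<epsilon>\<close> for the head and
    \<open>\<epsilon>\<close> for the construction, so a quarter of \<open>c - 1\<close> leaves
    \<open>1 + \<epsilon>\<close>.\<close>
  define \<epsilon> where "\<epsilon> = (c - 1) / 4"
  have \<epsilon>: "0 < \<epsilon>" "1 + 4 * \<epsilon> = c"
    using \<open>1 < c\<close> by (simp_all add: \<epsilon>_def field_simps)
  obtain Q :: "nat \<Rightarrow> nat set" where Q: "\<And>j. Q j \<in> J" "\<And>S. S \<in> J \<Longrightarrow> \<exists>j. S \<subseteq> Q j"
    by (rule countably_generated_idealE[OF J gen]) blast
  have reg: "ideal_regular I J a"
    by (rule regular_if_ideal_core_eq[OF a I J core])
  \<comment> \<open>Singletons lie in \<open>I\<close>, so every column tends to 0 along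
    \<open>J\<close>; this makes any fixed head of the rows eventually small.\<close>
  have column: "((\<lambda>n. a n k) \<longlongrightarrow> 0) (ideal_filter J)" for k
  proof -
    have "{k} \<in> I"
      using I by (simp add: is_ideal_def)
    moreover have "(\<Sum>i. a n i * indicator {k} i) = a n k" for n
      using suminf_finite[of "{k}" "\<lambda>i. a n i * indicator {k} i"] by simp
    ultimately show ?thesis
      using regular_row_sums(2)[OF I J reg, of "{k}"] by simp
  qed
  have "\<exists>n. (n \<notin> Q j \<and> (\<Sum>k<m. \<bar>a n k\<bar>) < \<epsilon>) \<and> c \<le> (\<Sum>k. \<bar>a n k\<bar>)" for j m
  proof -
    have "((\<lambda>n. \<Sum>k<m. \<bar>a n k\<bar>) \<longlongrightarrow> (\<Sum>k<m. \<bar>0\<bar>)) (ideal_filter J)"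
      by (intro tendsto_intros column)
    then have "\<forall>\<^sub>F n in ideal_filter J. (\<Sum>k<m. \<bar>a n k\<bar>) < \<epsilon>"
      using \<epsilon> by (intro order_tendstoD(2)) auto
    moreover have "\<forall>\<^sub>F n in ideal_filter J. n \<notin> Q j"
      by (simp add: eventually_ideal_filter[OF J] Q)
    ultimately have "\<forall>\<^sub>F n in ideal_filter J. n \<notin> Q j \<and> (\<Sum>k<m. \<bar>a n k\<bar>) < \<epsilon>"
      by eventually_elim auto
    with large have "\<exists>\<^sub>F n in ideal_filter J. (n \<notin> Q j \<and> (\<Sum>k<m. \<bar>a n k\<bar>) < \<epsilon>) \<and> c \<le> (\<Sum>k. \<bar>a n k\<bar>)"
      by (intro frequently_eventually_conj)
    then show ?thesis
      by (rule frequently_ex)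
  qed
  then obtain x where
    x: "\<And>k. \<bar>x k\<bar> \<le> 1" and hump: "\<And>j. \<exists>m n. ((n \<notin> Q j \<and> (\<Sum>k<m. \<bar>a n k\<bar>) < \<epsilon>)
      \<and> c \<le> (\<Sum>k. \<bar>a n k\<bar>)) \<and> (\<Sum>k. \<bar>a n k\<bar>) - 2 * (\<Sum>k<m. \<bar>a n k\<bar>) - \<epsilon> \<le> mat_app a x n"
    by (rule gliding_hump[where a = a and P =
          "\<lambda>j m n. (n \<notin> Q j \<and> (\<Sum>k<m. \<bar>a n k\<bar>) < \<epsilon>) \<and> c \<le> (\<Sum>k. \<bar>a n k\<bar>)", OF rows \<epsilon>(1)]) blast
  have xb: "bounded (range x)"
    using x by (auto simp: bounded_iff)
  have outside: "\<exists>n. n \<notin> Q j \<and> 1 + \<epsilon> \<le> mat_app a x n" for j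
    using hump[of j] \<epsilon> by force
  \<comment> \<open>Countable generation enters here: the hump rows escape every \<open>Q j\<close>,
    hence cannot all lie in one member of \<open>J\<close>.\<close>
  have "\<exists>\<^sub>F n in ideal_filter J. 1 + \<epsilon> \<le> mat_app a x n"
    unfolding frequently_ideal_filter[OF J]
  proof
    assume "{n. 1 + \<epsilon> \<le> mat_app a x n} \<in> J"
    with Q(2) obtain j where "{n. 1 + \<epsilon> \<le> mat_app a x n} \<subseteq> Q j"
      by blast
    with outside[of j] show False
      by auto
  qed
  then obtain y where y: "1 + \<epsilon> \<le> y" "y \<in> ideal_core J (mat_app a x)"
    by (rule ideal_core_above[OF J mat_class_l_inftyD(2)[OF a xb]])
  then have "\<exists>\<^sub>F k in ideal_filter I. 1 < x k"
    using \<epsilon> by (simp add: core[OF xb] in_ideal_core_iff[OF I])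
  then obtain k where "1 < x k"
    by (auto dest: frequently_ex)
  with x[of k] show False
    by auto
qed

text \<open>The indicator of a positive set has a core point at least 1, which equality of cores
  passes to its transform; absolute values only enlarge the row sum over \<open>E\<close>.\<close>

lemma frequently_abs_row_sum_greater:
  assumes a: "a \<in> mat_class l_infty l_infty" and I: "is_ideal I" and J: "is_ideal J"
    and core: "\<And>x. bounded (range x) \<Longrightarrow> ideal_core J (mat_app a x) = ideal_core I x"
    and E: "E \<notin> I" and "c < 1"
  shows "\<exists>\<^sub>F n in ideal_filter J. c < (\<Sum>k. \<bar>a n k\<bar> * indicator E k)"
proof -
  note rows = mat_class_abs_summable[OF a]
  have bE: "bounded (range (indicator E :: nat \<Rightarrow> real))"
    by (auto simp: bounded_iff indicator_def intro!: exI[of _ 1])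
  have freqE: "\<exists>\<^sub>F k in ideal_filter I. 1 \<le> (indicator E k :: real)"
    using E by (simp add: frequently_ideal_filter[OF I] indicator_def)
  obtain y where y: "1 \<le> y" "y \<in> ideal_core I (indicator E)"
    by (rule ideal_core_above[OF I bE freqE])
  then have "\<exists>\<^sub>F n in ideal_filter J. c < mat_app a (indicator E) n"
    using \<open>c < 1\<close> by (simp add: core[OF bE, symmetric] in_ideal_core_iff[OF J])
  moreover have "mat_app a (indicator E) n \<le> (\<Sum>k. \<bar>a n k\<bar> * indicator E k)" for n
    unfolding mat_app_def
    by (intro suminf_le mat_class_l_inftyD(1)[OF a bE] abs_summable_mult_bounded[where M = 1])
      (use rows in \<open>auto simp: indicator_def\<close>)
  ultimately show ?thesis
    by (auto elim!: frequently_elim1 intro: less_le_trans)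
qed

theorem theorem2p3:
  fixes a :: "nat \<Rightarrow> nat \<Rightarrow> real" and I J :: "nat set set"
  assumes "a \<in> mat_class l_infty l_infty"
    and "is_ideal I" and "is_ideal J"
    and "countably_generated_ideal J"
  shows "(\<forall>x\<in>l_infty. ideal_core J (mat_app a x) = ideal_core I x) \<longleftrightarrow>
    (ideal_regular I J a \<and>
     (\<forall>E\<in>ideal_pos I. ideal_limsup J (\<lambda>n. \<Sum>\<^sub>\<infinity>k\<in>E. \<bar>a n k\<bar>) = 1))"
    (is "?core \<longleftrightarrow> ?reg \<and> ?L2")
proof -
  note a = assms(1) and I = assms(2) and J = assms(3) and gen = assms(4)
  note rows = mat_class_abs_summable[OF a]
  have L2_iff: "?L2 \<longleftrightarrow>
      (\<forall>E. E \<notin> I \<longrightarrow> ideal_limsup J (\<lambda>n. \<Sum>k. \<bar>a n k\<bar> * indicator E k) = 1)"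
    by (simp add: ideal_pos_def infsum_abs_eq_suminf[OF rows])
  show ?thesis
  proof
    assume ?core
    then have core: "\<And>x. bounded (range x) \<Longrightarrow> ideal_core J (mat_app a x) = ideal_core I x"
      by (simp add: l_infty_def)
    have "ideal_limsup J (\<lambda>n. \<Sum>k. \<bar>a n k\<bar> * indicator E k) = 1" if "E \<notin> I" for E
    proof (rule ideal_limsup_eqI[OF J])
      fix c :: real
      assume "1 < c"
      \<comment> \<open>The upper estimate concerns whole rows; the part over \<open>E\<close>
        inherits it.\<close>
      have le: "(\<Sum>k. \<bar>a n k\<bar> * indicator E k) \<le> (\<Sum>k. \<bar>a n k\<bar>)" for n
        by (intro suminf_le rows abs_summable_mult_bounded[where M = 1])
          (use rows in \<open>auto simp: indicator_def\<close>)
      show "\<forall>\<^sub>F n in ideal_filter J. (\<Sum>k. \<bar>a n k\<bar> * indicator E k) < c"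
        using eventually_abs_row_sum_less[OF a I J gen core \<open>1 < c\<close>]
        by (rule eventually_mono) (use le le_less_trans in blast)+
    qed (rule frequently_abs_row_sum_greater[OF a I J core that])
    then show "?reg \<and> ?L2"
      using regular_if_ideal_core_eq[OF a I J core] by (simp add: L2_iff)
  next
    assume "?reg \<and> ?L2"
    then have above: "(\<forall>c<y. \<exists>\<^sub>F n in ideal_filter J. c < mat_app a x n) \<longleftrightarrow>
        (\<forall>c<y. \<exists>\<^sub>F k in ideal_filter I. c < x k)" if "bounded (range x)" for x y
      using frequently_above_iff[OF a I J _ _ that] by (simp add: L2_iff)
    show ?core
    proof
      fix x
      assume "x \<in> l_infty"
      then have x: "bounded (range x)" and x': "bounded (range (\<lambda>k. - x k))"
        by (auto simp: l_infty_def bounded_iff)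
      have minus: "mat_app a (\<lambda>k. - x k) n = - mat_app a x n" for n
        unfolding mat_app_def using suminf_minus[OF mat_class_l_inftyD(1)[OF a x, of n]] by simp
      \<comment> \<open>The lower half of core membership is the upper half for \<open>- x\<close>
        at \<open>- y\<close>.\<close>
      have "(\<forall>c>y. \<exists>\<^sub>F n in ideal_filter J. mat_app a x n < c) \<longleftrightarrow>
          (\<forall>c>y. \<exists>\<^sub>F k in ideal_filter I. x k < c)" for y
        using above[OF x', of "- y"] by (simp add: minus all_less_uminus_iff)
      then show "ideal_core J (mat_app a x) = ideal_core I x"
        using above[OF x] by (auto simp: in_ideal_core_iff[OF I] in_ideal_core_iff[OF J])
    qed
  qed
qed

end
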